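(* Let $\Gamma=M\mathbb{Z}^n$ be a lattice in $\mathbb{R}^n$ (or $\mathbb{C}^n$), where $M$ is an invertible real (or complex) $n\times n$ matrix, and let $A$ be a dilation matrix for $\Gamma$. Let $F_\Gamma=M([-\tfrac12,\tfrac12)^n)$ and $D=A(F_\Gamma)\cap\Gamma$. Then there exists a finite set $S\subset\Gamma$ such that every $x\in\Gamma$ satisfies exactly one of: (1) $x=\sum_{j=0}^{N}A^jd_j$ for some $N\ge0$ and $d_j\in D$; (2) $x=A^Ns+\sum_{j=0}^{N-1}A^jd_j$ for some $N\ge0$, $s\in S$, $d_j\in D$.
   Context: An integer dilation matrix is an $n\times n$ matrix with integer entries all of whose eigenvalues $\lambda$ satisfy $|\lambda|>1$. A matrix $A$ is a dilation matrix for $\Gamma=M\mathbb{Z}^n$ if $B=M^{-1}AM$ is an integer dilation matrix (so $A$ maps $\Gamma$ into itself with nontrivial cokernel). *)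

theory Defs
  imports "HOL-Analysis.Analysis"
begin

text \<open>Matrix powers for square matrices (Cartesian-product representation).\<close>
primrec matpow :: "'a::semiring_1^'n^'n \<Rightarrow> nat \<Rightarrow> 'a^'n^'n" where
  "matpow A 0 = mat 1"
| "matpow A (Suc k) = A ** matpow A k"

text \<open>Integer dilation matrix: integer entries, every (complex) eigenvalue has modulus > 1.\<close>
definition int_dilation :: "int^'n^'n \<Rightarrow> bool" where
  "int_dilation B \<longleftrightarrow>
     (\<forall>(c::complex) (v::complex^'n). v \<noteq> 0 \<and> map_matrix of_int B *v v = c *s v \<longrightarrow> 1 < cmod c)"

text \<open>The lattice M Z^n, over a real normed field (reals or complexes).\<close>
definition lattice :: "'a::real_normed_field^'n^'n \<Rightarrow> ('a^'n) set" where
  "lattice M = {M *v (\<chi> i. of_int (k i)) | k. True}"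

text \<open>A is a dilation matrix for Gamma = M Z^n: M^-1 A M is an integer dilation matrix.\<close>
definition dilation_for :: "'a::real_normed_field^'n^'n \<Rightarrow> 'a^'n^'n \<Rightarrow> bool" where
  "dilation_for M A \<longleftrightarrow>
     (\<exists>B. int_dilation B \<and> matrix_inv M ** A ** M = map_matrix of_int B)"

text \<open>Fundamental domain F_Gamma = M([-1/2,1/2)^n).\<close>
definition fund_dom :: "'a::real_normed_field^'n^'n \<Rightarrow> ('a^'n) set" where
  "fund_dom M = {M *v (\<chi> i. of_real (t i)) | t. \<forall>i. -1/2 \<le> t i \<and> t i < 1/2}"

end

theory Submission
  imports Defs "Jordan_Normal_Form.Spectral_Radius"
begin

(* Proof idea.  Write A = M B M^-1 with B an integer dilation matrix.  The map k |-> M k identifies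
   Z^n with Gamma, intertwines B with A, and maps the integer digit set
   digits = Z^n \<inter> B([-1/2,1/2)^n) onto D; so it suffices to prove the statement for B on Z^n.
   There, every k is uniquely d + B m with a digit d ("division with remainder"), and the radix
   map quot k = m satisfies quot k = B^-1 k - t with t in the half cube.  Since all eigenvalues
   of B^-1 lie in the open unit disc, the operator norms of its powers are summable (via the
   spectral radius theory of Jordan_Normal_Form), so every orbit of quot eventually stays in a
   fixed ball, which contains only finitely many lattice points.  A general orbit dichotomy for
   such maps with the fixed point 0 then shows: every orbit reaches either 0 or the finite set S
   of nonzero periodic points, never both.  Reaching 0 means a finite expansion (1); reaching S
   after N steps means an expansion of type (2).

   File structure: matrix preliminaries; the bridge to Jordan_Normal_Form and the summability of
   powers of a contracting matrix; the orbit dichotomy; integer/real vector embeddings and the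
   half cube; the digit system of B (locale int_dilation_system); the transfer to the lattice
   (locale lattice_dilation); the main theorem. *)

text \<open>Jordan_Normal_Form's vector indexing and scalar product notations clash with those of
  the Cartesian-product vectors used throughout; its \<open>mat\<close>/\<open>vec\<close> constructors are only used
  qualified.\<close>
no_notation vec_index (infixl "$" 100)
no_notation scalar_prod (infix "\<bullet>" 70)
hide_const (open) Lattice.lattice Matrix.mat Matrix.vec

text \<open>Elementary facts about matrix powers and Cartesian matrix-vector products.\<close>

lemma matpow_Suc_right: "matpow (X::'a::semiring_1^'n^'n) (Suc k) = matpow X k ** X"
  by (induction k) (simp_all add: matrix_mul_assoc)

lemma matpow_scaleR: "matpow (c *\<^sub>R (X::real^'n::finite^'n)) k = (c ^ k) *\<^sub>R matpow X k"
  by (induction k)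
     (simp_all add: Finite_Cartesian_Product.vec_eq_iff matrix_matrix_mult_def sum_distrib_left algebra_simps)

lemma matrix_inv_both_sides:
  assumes "invertible (A::'a::semiring_1^'n^'n)"
  shows "A ** matrix_inv A = mat 1" "matrix_inv A ** A = mat 1"
  using someI_ex[OF assms[unfolded invertible_def]] unfolding matrix_inv_def by auto

lemma matrix_vector_mult_sum:
  "(A::'a::comm_ring_1^'n^'m) *v sum f S = (\<Sum>x\<in>S. A *v f x)"
  by (induction S rule: infinite_finite_induct) (simp_all add: matrix_vector_right_distrib)

text \<open>A bridge to the matrices of \<open>Jordan_Normal_Form\<close>, whose spectral-radius theory we use.
  The index type \<open>'n\<close> is enumerated by \<open>{..<CARD('n)}\<close>.\<close>

definition enum_idx :: "nat \<Rightarrow> 'n::finite" where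
  "enum_idx = from_nat_into UNIV"

definition idx_of :: "'n::finite \<Rightarrow> nat" where
  "idx_of = inv_into {..<CARD('n)} enum_idx"

lemma enum_idx_bij: "bij_betw (enum_idx :: nat \<Rightarrow> 'n::finite) {..<CARD('n)} UNIV"
  unfolding enum_idx_def using bij_betw_from_nat_into_finite[of "UNIV::'n set"] by simp

lemma idx_of_less [simp]: "idx_of (a::'n::finite) < CARD('n)"
  unfolding idx_of_def using enum_idx_bij[where 'n='n]
  by (metis bij_betw_def inv_into_into lessThan_iff UNIV_I)

lemma enum_idx_idx_of [simp]: "enum_idx (idx_of (a::'n::finite)) = a"
  unfolding idx_of_def using enum_idx_bij[where 'n='n]
  by (metis bij_betw_def f_inv_into_f UNIV_I)

lemma idx_of_enum_idx [simp]: "i < CARD('n::finite) \<Longrightarrow> idx_of (enum_idx i :: 'n) = i"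
  unfolding idx_of_def using enum_idx_bij[where 'n='n]
  by (metis bij_betw_def inv_into_f_f lessThan_iff)

lemma sum_UNIV_enum_idx: "(\<Sum>a\<in>(UNIV::'n::finite set). f a) = (\<Sum>i<CARD('n). f (enum_idx i))"
  using sum.reindex_bij_betw[OF enum_idx_bij[where 'n='n], of f] by simp

definition to_jnf :: "real^'n^'n \<Rightarrow> complex mat" where
  "to_jnf X = Matrix.mat CARD('n::finite) CARD('n) (\<lambda>(i,j). complex_of_real (X $ enum_idx i $ enum_idx j))"

definition jnf_vec :: "complex^'n \<Rightarrow> complex Matrix.vec" where
  "jnf_vec w = Matrix.vec CARD('n::finite) (\<lambda>i. w $ enum_idx i)"

lemma to_jnf_carrier: "to_jnf (X::real^'n::finite^'n) \<in> carrier_mat CARD('n) CARD('n)"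
  unfolding to_jnf_def by simp

lemma to_jnf_dim [simp]:
  "dim_row (to_jnf (X::real^'n::finite^'n)) = CARD('n)" "dim_col (to_jnf X) = CARD('n)"
  unfolding to_jnf_def by auto

lemma to_jnf_mult: "to_jnf ((X::real^'n::finite^'n) ** Y) = to_jnf X * to_jnf Y"
proof (rule eq_matI)
  fix i j assume "i < dim_row (to_jnf X * to_jnf Y)" "j < dim_col (to_jnf X * to_jnf Y)"
  then have i: "i < CARD('n)" and j: "j < CARD('n)" by auto
  have "(to_jnf X * to_jnf Y) $$ (i,j)
      = (\<Sum>k<CARD('n). complex_of_real (X $ enum_idx i $ enum_idx k) * complex_of_real (Y $ enum_idx k $ enum_idx j))"
    using i j by (simp add: to_jnf_def scalar_prod_def row_def col_def lessThan_atLeast0)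
  also have "\<dots> = complex_of_real (\<Sum>k\<in>UNIV. X $ enum_idx i $ k * Y $ k $ enum_idx j)"
    by (simp add: sum_UNIV_enum_idx)
  finally show "to_jnf (X ** Y) $$ (i, j) = (to_jnf X * to_jnf Y) $$ (i, j)"
    using i j by (simp add: to_jnf_def matrix_matrix_mult_def)
qed auto

lemma to_jnf_one: "to_jnf (mat 1 :: real^'n::finite^'n) = 1\<^sub>m CARD('n)"
proof (rule eq_matI)
  fix i j assume "i < dim_row (1\<^sub>m CARD('n))" "j < dim_col (1\<^sub>m CARD('n))"
  then have i: "i < CARD('n)" and j: "j < CARD('n)" by auto
  then have "(enum_idx i = (enum_idx j :: 'n)) = (i = j)" by (metis idx_of_enum_idx)
  then show "to_jnf (mat 1 :: real^'n^'n) $$ (i, j) = 1\<^sub>m CARD('n) $$ (i, j)"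
    using i j by (simp add: to_jnf_def Finite_Cartesian_Product.mat_def)
qed auto

lemma to_jnf_matpow: "to_jnf (matpow (X::real^'n::finite^'n) k) = to_jnf X ^\<^sub>m k"
  by (induction k) (simp_all add: to_jnf_one to_jnf_mult matpow_Suc_right del: matpow.simps(2))

lemma to_jnf_mult_jnf_vec:
  "to_jnf X *\<^sub>v jnf_vec w = jnf_vec (map_matrix complex_of_real (X::real^'n::finite^'n) *v w)"
  by (rule eq_vecI)
     (simp_all add: to_jnf_def jnf_vec_def mult_mat_vec_def scalar_prod_def row_def
       lessThan_atLeast0 matrix_vector_mult_def sum_UNIV_enum_idx)

lemma jnf_vec_smult: "\<mu> \<cdot>\<^sub>v jnf_vec w = jnf_vec (\<mu> *s w)"
  by (rule eq_vecI) (simp_all add: jnf_vec_def)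

lemma jnf_vec_inj: "jnf_vec v = jnf_vec w \<Longrightarrow> v = (w::complex^'n::finite)"
proof -
  assume eq: "jnf_vec v = jnf_vec w"
  have "v $ a = w $ a" for a
  proof -
    have "vec_index (jnf_vec v) (idx_of a) = vec_index (jnf_vec w) (idx_of a)" using eq by simp
    then show ?thesis by (simp add: jnf_vec_def)
  qed
  then show "v = w" by (simp add: Finite_Cartesian_Product.vec_eq_iff)
qed

lemma jnf_vec_surj: "u \<in> carrier_vec CARD('n::finite) \<Longrightarrow> \<exists>w::complex^'n. u = jnf_vec w"
  by (rule exI[of _ "\<chi> a. vec_index u (idx_of a)"], rule eq_vecI) (simp_all add: jnf_vec_def)

lemma jnf_vec_carrier [simp]: "jnf_vec (w::complex^'n::finite) \<in> carrier_vec CARD('n)"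
  by (simp add: jnf_vec_def)

lemma jnf_vec_zero: "0\<^sub>v CARD('n::finite) = jnf_vec (0::complex^'n)"
  by (rule eq_vecI) (simp_all add: jnf_vec_def)

text \<open>A complex eigenvalue of a real square matrix, in the Cartesian representation.\<close>
definition complex_eigenvalue :: "real^'n^'n \<Rightarrow> complex \<Rightarrow> bool" where
  "complex_eigenvalue X \<mu> \<longleftrightarrow> (\<exists>w::complex^'n. w \<noteq> 0 \<and> map_matrix complex_of_real X *v w = \<mu> *s w)"

lemma eigenvalue_to_jnf_iff: "eigenvalue (to_jnf (X::real^'n::finite^'n)) \<mu> \<longleftrightarrow> complex_eigenvalue X \<mu>"
proof
  assume "eigenvalue (to_jnf X) \<mu>"
  then obtain u where u: "u \<in> carrier_vec CARD('n)" "u \<noteq> 0\<^sub>v CARD('n)" "to_jnf X *\<^sub>v u = \<mu> \<cdot>\<^sub>v u"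
    unfolding eigenvalue_def eigenvector_def by auto
  obtain w :: "complex^'n" where w: "u = jnf_vec w" using jnf_vec_surj[OF u(1)] by blast
  have "w \<noteq> 0" using u(2) w jnf_vec_zero by metis
  moreover have "map_matrix complex_of_real X *v w = \<mu> *s w"
    using u(3) unfolding w to_jnf_mult_jnf_vec jnf_vec_smult by (rule jnf_vec_inj)
  ultimately show "complex_eigenvalue X \<mu>" unfolding complex_eigenvalue_def by blast
next
  assume "complex_eigenvalue X \<mu>"
  then obtain w where w: "w \<noteq> 0" "map_matrix complex_of_real X *v w = \<mu> *s w"
    unfolding complex_eigenvalue_def by blast
  have "jnf_vec w \<noteq> 0\<^sub>v CARD('n)" using w(1) jnf_vec_inj unfolding jnf_vec_zero by blast
  moreover have "to_jnf X *\<^sub>v jnf_vec w = \<mu> \<cdot>\<^sub>v jnf_vec w"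
    by (simp add: to_jnf_mult_jnf_vec jnf_vec_smult w(2))
  ultimately show "eigenvalue (to_jnf X) \<mu>"
    unfolding eigenvalue_def eigenvector_def to_jnf_dim by (intro exI[of _ "jnf_vec w"]) simp
qed

text \<open>If every complex eigenvalue of a real matrix lies in the open unit disc, its powers decay
  geometrically in operator norm; in particular their operator norms are summable.  We pick \<open>r\<close> strictly between the spectral
  radius and \<open>1\<close>; the matrix \<open>C / r\<close> still has spectral radius below \<open>1\<close>, so its powers are
  bounded by the Jordan normal form theory.\<close>

lemma map_matrix_scaleR_mult:
  "map_matrix complex_of_real (c *\<^sub>R (X::real^'n::finite^'n)) *v w
     = complex_of_real c *s (map_matrix complex_of_real X *v w)"
  by (simp add: Finite_Cartesian_Product.vec_eq_iff matrix_vector_mult_def sum_distrib_left mult.assoc)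

lemma matpow_norms_summable:
  fixes C :: "real^'n::finite^'n"
  assumes small: "\<And>\<mu>. complex_eigenvalue C \<mu> \<Longrightarrow> norm \<mu> < 1"
  shows "summable (\<lambda>k. onorm ((*v) (matpow C k)))"
proof -
  note radius = spectral_radius_mem_max[OF to_jnf_carrier zero_less_card_finite]
  define \<rho> where "\<rho> = spectral_radius (to_jnf C)"
  obtain \<mu>0 where "eigenvalue (to_jnf C) \<mu>0" "\<rho> = norm \<mu>0"
    using radius(1)[of C] unfolding \<rho>_def spectrum_def by auto
  then have "0 \<le> \<rho>" "\<rho> < 1" using small by (auto simp: eigenvalue_to_jnf_iff)
  define r where "r = (1 + \<rho>) / 2"
  have r: "0 < r" "r < 1" "\<rho> < r" using \<open>0 \<le> \<rho>\<close> \<open>\<rho> < 1\<close> by (auto simp: r_def)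
  define X where "X = (1 / r) *\<^sub>R C"
  have C_eq: "C = r *\<^sub>R X" using r by (simp add: X_def)
  have X_small: "norm \<mu> < 1" if "complex_eigenvalue X \<mu>" for \<mu>
  proof -
    from that obtain w where "w \<noteq> 0" "map_matrix complex_of_real X *v w = \<mu> *s w"
      unfolding complex_eigenvalue_def by blast
    then have "complex_eigenvalue C (complex_of_real r * \<mu>)"
      unfolding complex_eigenvalue_def C_eq map_matrix_scaleR_mult by auto
    then have "norm (complex_of_real r * \<mu>) \<le> \<rho>"
      using radius(2) unfolding \<rho>_def spectrum_def eigenvalue_to_jnf_iff[symmetric] by blast
    moreover have "norm (complex_of_real r * \<mu>) = r * norm \<mu>" using r by (simp add: norm_mult)
    ultimately have "r * norm \<mu> < r * 1" using r by linarith
    with r(1) show ?thesis by (simp only: mult_less_cancel_left_pos)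
  qed
  have "spectral_radius (to_jnf X) < 1"
    using radius(1)[of X] X_small by (auto simp: spectrum_def eigenvalue_to_jnf_iff)
  then obtain c where c: "\<And>k. norm_bound (to_jnf X ^\<^sub>m k) c"
    using spectral_radius_jnf_norm_bound_less_1_upper_triangular[OF to_jnf_carrier] by blast
  have entry: "\<bar>matpow C k $ a $ b\<bar> \<le> c * r ^ k" for k a b
  proof -
    have "norm ((to_jnf X ^\<^sub>m k) $$ (idx_of a, idx_of b)) \<le> c"
      using c[of k] unfolding norm_bound_def to_jnf_matpow[symmetric] by simp
    then have "\<bar>matpow X k $ a $ b\<bar> \<le> c"
      unfolding to_jnf_matpow[symmetric] by (simp add: to_jnf_def)
    moreover have "matpow C k $ a $ b = r ^ k * matpow X k $ a $ b"
      by (simp add: C_eq matpow_scaleR)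
    ultimately show ?thesis using r by (simp add: abs_mult mult.commute mult_left_mono)
  qed
  define K where "K = real CARD('n) * real CARD('n) * c"
  have bound: "norm (onorm ((*v) (matpow C k))) \<le> K * r ^ k" for k
    using onorm_le_matrix_component[OF entry, of k]
      onorm_pos_le[OF matrix_vector_mul_bounded_linear, of "matpow C k"]
    by (simp add: K_def mult.assoc)
  have geometric: "summable (\<lambda>k. K * r ^ k)" using r by (intro summable_mult summable_geometric) simp
  show ?thesis by (rule summable_comparison_test'[OF geometric]) (rule bound)
qed

text \<open>Orbit dichotomy for a self-map \<open>f\<close> with a fixed point \<open>z\<close>, all of whose orbits eventually
  stay in one finite set: the periodic points other than \<open>z\<close> form a finite set, and every orbit
  reaches either \<open>z\<close> or one of these periodic points, but never both.\<close>

definition periodic_points :: "('b \<Rightarrow> 'b) \<Rightarrow> 'b set" where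
  "periodic_points f = {x. \<exists>p>0. (f ^^ p) x = x}"

lemma funpow_apply_add: "(f ^^ m) ((f ^^ n) x) = (f ^^ (m + n)) x"
  by (simp add: funpow_add)

lemma funpow_fixed_point: "f z = z \<Longrightarrow> (f ^^ n) z = z"
  by (induction n) auto

lemma periodic_point_in_limit_set:
  assumes "x \<in> periodic_points f" and "\<forall>m\<ge>m0. (f ^^ m) x \<in> F"
  shows "x \<in> F"
proof -
  obtain p where "p > 0" "(f ^^ p) x = x" using assms(1) unfolding periodic_points_def by blast
  then have "(f ^^ (p * m0)) x = x" using funpow_mod_eq[where f=f and n=p and x=x and m="p * m0"] by simp
  moreover have "p * m0 \<ge> m0" using \<open>p > 0\<close> by simp
  ultimately show ?thesis using assms(2) by metis
qed

text \<open>By pigeonhole, an orbit that eventually stays in a finite set hits a periodic point.\<close>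
lemma orbit_reaches_periodic_point:
  assumes "finite F" and "\<forall>m\<ge>m0. (f ^^ m) x \<in> F"
  shows "\<exists>a. (f ^^ a) x \<in> periodic_points f"
proof -
  let ?I = "{m0..m0 + card F}"
  have "(\<lambda>m. (f ^^ m) x) ` ?I \<subseteq> F" using assms(2) by auto
  then have "card ((\<lambda>m. (f ^^ m) x) ` ?I) \<le> card F" by (rule card_mono[OF assms(1)])
  then have "\<not> inj_on (\<lambda>m. (f ^^ m) x) ?I" using card_image by fastforce
  then obtain a b where "a \<noteq> b" "(f ^^ a) x = (f ^^ b) x"
    unfolding inj_on_def by blast
  then obtain a b where ab: "a < b" "(f ^^ a) x = (f ^^ b) x"
    by (metis linorder_neqE_nat)
  have "(f ^^ (b - a)) ((f ^^ a) x) = (f ^^ b) x"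
    using ab(1) by (simp add: funpow_apply_add)
  then have "(f ^^ (b - a)) ((f ^^ a) x) = (f ^^ a) x" using ab(2) by simp
  with ab(1) have "(f ^^ a) x \<in> periodic_points f"
    unfolding periodic_points_def by (intro CollectI exI[of _ "b - a"]) simp
  then show ?thesis by blast
qed

text \<open>A periodic point from which the fixed point \<open>z\<close> is reachable is \<open>z\<close> itself.\<close>
lemma periodic_point_reaching_fixed_point:
  assumes "f z = z" and "y \<in> periodic_points f" and "(f ^^ a) y = z"
  shows "y = z"
proof -
  obtain p where "p > 0" "(f ^^ p) y = y" using assms(2) unfolding periodic_points_def by blast
  then have "y = (f ^^ (p * a)) y" using funpow_mod_eq[where f=f and n=p and x=y and m="p * a"] by simp
  also have "\<dots> = (f ^^ (p * a - a)) ((f ^^ a) y)"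
    using \<open>p > 0\<close> by (simp add: funpow_apply_add)
  also have "\<dots> = z" using assms(1,3) funpow_fixed_point by metis
  finally show ?thesis .
qed

lemma orbit_dichotomy:
  assumes fin: "finite F" and ev: "\<And>x. \<exists>m0. \<forall>m\<ge>m0. (f ^^ m) x \<in> F" and fixed: "f z = z"
  shows "finite (periodic_points f - {z})"
    and "(\<exists>a. (f ^^ a) x = z) \<noteq> (\<exists>N. (f ^^ N) x \<in> periodic_points f - {z})"
proof -
  have "periodic_points f \<subseteq> F"
  proof
    fix y assume "y \<in> periodic_points f"
    moreover obtain m0 where "\<forall>m\<ge>m0. (f ^^ m) y \<in> F" using ev by blast
    ultimately show "y \<in> F" by (rule periodic_point_in_limit_set)
  qed
  then show "finite (periodic_points f - {z})" using fin finite_subset by blast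
  show "(\<exists>a. (f ^^ a) x = z) \<noteq> (\<exists>N. (f ^^ N) x \<in> periodic_points f - {z})"
  proof (cases "\<exists>a. (f ^^ a) x = z")
    case True
    then obtain a where a: "(f ^^ a) x = z" by blast
    have "(f ^^ N) x \<notin> periodic_points f - {z}" for N
    proof
      assume N: "(f ^^ N) x \<in> periodic_points f - {z}"
      have "(f ^^ a) ((f ^^ N) x) = (f ^^ N) ((f ^^ a) x)"
        by (simp add: funpow_apply_add add.commute)
      also have "\<dots> = z" using a funpow_fixed_point[where f=f, OF fixed] by simp
      finally show False using periodic_point_reaching_fixed_point[where f=f, OF fixed] N by blast
    qed
    with True show ?thesis by blast
  next
    case False
    obtain m0 where "\<forall>m\<ge>m0. (f ^^ m) x \<in> F" using ev by blast
    then obtain a where "(f ^^ a) x \<in> periodic_points f"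
      using orbit_reaches_periodic_point[OF fin] by blast
    moreover have "(f ^^ a) x \<noteq> z" using False by blast
    ultimately show ?thesis using False by blast
  qed
qed

text \<open>Embeddings of integer and real vectors into vectors over a larger ring, and their
  compatibility with integer matrices.\<close>

definition of_int_vec :: "int^'n \<Rightarrow> 'a::ring_1^'n" where
  "of_int_vec k = (\<chi> i. of_int (k $ i))"

definition of_real_vec :: "real^'n \<Rightarrow> 'a::real_algebra_1^'n" where
  "of_real_vec t = (\<chi> i. of_real (t $ i))"

lemma of_int_vec_add: "of_int_vec (a + b) = of_int_vec a + of_int_vec b"
  by (simp add: of_int_vec_def Finite_Cartesian_Product.vec_eq_iff)

lemma of_int_vec_diff: "of_int_vec (a - b) = of_int_vec a - of_int_vec b"
  by (simp add: of_int_vec_def Finite_Cartesian_Product.vec_eq_iff)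

lemma of_int_vec_0 [simp]: "of_int_vec 0 = 0"
  by (simp add: of_int_vec_def Finite_Cartesian_Product.vec_eq_iff)

lemma of_int_vec_inj: "of_int_vec a = (of_int_vec b :: 'a::ring_char_0^'n) \<Longrightarrow> a = b"
  by (simp add: of_int_vec_def Finite_Cartesian_Product.vec_eq_iff)

lemma of_int_matrix_mult_vec:
  "map_matrix of_int B *v of_int_vec k = (of_int_vec (B *v k) :: 'a::ring_1^'m)"
  for B :: "int^'n::finite^'m"
  by (simp add: Finite_Cartesian_Product.vec_eq_iff of_int_vec_def matrix_vector_mult_def)

lemma of_real_vec_0 [simp]: "of_real_vec 0 = 0"
  by (simp add: of_real_vec_def Finite_Cartesian_Product.vec_eq_iff)

lemma of_real_of_int_vec: "of_real_vec (of_int_vec k) = of_int_vec k"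
  by (simp add: of_real_vec_def of_int_vec_def Finite_Cartesian_Product.vec_eq_iff)

lemma of_real_vec_inj: "of_real_vec s = (of_real_vec t :: 'a::real_algebra_1^'n) \<Longrightarrow> s = t"
  by (simp add: of_real_vec_def Finite_Cartesian_Product.vec_eq_iff)

lemma of_int_matrix_mult_of_real_vec:
  "map_matrix of_int B *v of_real_vec t
     = (of_real_vec (map_matrix real_of_int B *v t) :: 'a::real_algebra_1^'m)"
  for B :: "int^'n::finite^'m"
  by (simp add: Finite_Cartesian_Product.vec_eq_iff of_real_vec_def matrix_vector_mult_def)

text \<open>The half-open cube \<open>[-1/2, 1/2)\<^sup>n\<close>, a fundamental domain of \<open>\<int>\<^sup>n\<close>.\<close>
definition half_cube :: "(real^'n) set" where
  "half_cube = {t. \<forall>i. -1/2 \<le> t $ i \<and> t $ i < 1/2}"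

lemma half_cube_norm: "t \<in> half_cube \<Longrightarrow> norm (t::real^'n::finite) \<le> real CARD('n)"
proof -
  assume "t \<in> half_cube"
  then have bounds: "-1/2 \<le> t $ i" "t $ i < 1/2" for i by (auto simp: half_cube_def)
  have "\<bar>t $ i\<bar> \<le> 1" for i using bounds[of i] by linarith
  then have "(\<Sum>i\<in>UNIV. \<bar>t $ i\<bar>) \<le> (\<Sum>i\<in>(UNIV::'n set). 1)" by (intro sum_mono)
  then show ?thesis using norm_le_l1_cart[of t] by simp
qed

text \<open>Rounding to the nearest integer vector: every real vector is an integer vector plus a
  point of the half cube, and two integer vectors differing by a difference of points of the half
  cube coincide.\<close>

lemma round_to_half_cube: "\<exists>m. t - of_int_vec m \<in> half_cube"
proof
  let ?m = "\<chi> i. \<lfloor>t $ i + 1/2\<rfloor>"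
  have "-1/2 \<le> t $ i - of_int \<lfloor>t $ i + 1/2\<rfloor> \<and> t $ i - of_int \<lfloor>t $ i + 1/2\<rfloor> < 1/2" for i
    by linarith
  then show "t - of_int_vec ?m \<in> half_cube" by (simp add: half_cube_def of_int_vec_def)
qed

lemma half_cube_difference_integral:
  assumes "s \<in> half_cube" "t \<in> half_cube" "s - t = of_int_vec m"
  shows "m = 0"
proof -
  have "m $ i = 0" for i
  proof -
    have "real_of_int (m $ i) = s $ i - t $ i"
      using assms(3) by (simp add: of_int_vec_def Finite_Cartesian_Product.vec_eq_iff)
    moreover have "-1/2 \<le> s $ i" "s $ i < 1/2" "-1/2 \<le> t $ i" "t $ i < 1/2"
      using assms(1,2) by (auto simp: half_cube_def)
    ultimately have "\<bar>real_of_int (m $ i)\<bar> < 1" by linarith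
    then show ?thesis by linarith
  qed
  then show ?thesis by (simp add: Finite_Cartesian_Product.vec_eq_iff)
qed

text \<open>Digit systems of an integer dilation matrix \<open>B\<close>.  The digits are the integer points of
  \<open>B\<close>(half cube).  Every integer vector \<open>k\<close> is uniquely \<open>d + B m\<close> with a digit \<open>d\<close>; the map
  \<open>k \<mapsto> m\<close> is the radix map \<open>quot\<close>.  Since \<open>B\<^sup>-\<^sup>1\<close> is contracting, all orbits of \<open>quot\<close> eventually
  stay in a bounded, hence finite, set.\<close>

locale int_dilation_system =
  fixes B :: "int^'n::finite^'n"
  assumes dilation: "int_dilation B"
begin

definition B_real :: "real^'n^'n" where
  "B_real = map_matrix real_of_int B"

definition C :: "real^'n^'n" where
  "C = matrix_inv B_real"

definition digits :: "(int^'n) set" where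
  "digits = {d. \<exists>t\<in>half_cube. B_real *v t = of_int_vec d}"

lemma B_real_of_int_vec: "B_real *v of_int_vec m = of_int_vec (B *v m)"
  by (simp add: B_real_def of_int_matrix_mult_vec)

text \<open>No eigenvalue of \<open>B\<close> vanishes, so \<open>B\<close> is invertible over the reals.\<close>
lemma B_real_kernel: "B_real *v t = 0 \<Longrightarrow> t = 0"
proof (rule ccontr)
  assume Bt: "B_real *v t = 0" and "t \<noteq> 0"
  then have "of_real_vec t \<noteq> (0::complex^'n)"
    using of_real_vec_inj[of t 0] by auto
  moreover have "map_matrix of_int B *v of_real_vec t = (of_real_vec (B_real *v t) :: complex^'n)"
    by (simp add: of_int_matrix_mult_of_real_vec B_real_def)
  then have "map_matrix of_int B *v of_real_vec t = 0 *s (of_real_vec t :: complex^'n)"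
    using Bt by simp
  ultimately have "1 < cmod 0" using dilation unfolding int_dilation_def by blast
  then show False by simp
qed

lemma C_inverse: "B_real ** C = mat 1" "C ** B_real = mat 1"
proof -
  have "invertible B_real"
    using B_real_kernel matrix_left_invertible_ker invertible_left_inverse by blast
  then show "B_real ** C = mat 1" "C ** B_real = mat 1"
    unfolding C_def by (rule matrix_inv_both_sides)+
qed

text \<open>The eigenvalues of \<open>C = B\<^sup>-\<^sup>1\<close> are the inverses of those of \<open>B\<close>, hence lie in the unit disc.\<close>
lemma C_eigenvalue_small: "complex_eigenvalue C \<mu> \<Longrightarrow> norm \<mu> < 1"
proof -
  assume "complex_eigenvalue C \<mu>"
  then obtain w where w: "w \<noteq> 0" "map_matrix complex_of_real C *v w = \<mu> *s w"
    unfolding complex_eigenvalue_def by blast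
  define Bc :: "complex^'n^'n" where "Bc = map_matrix of_int B"
  have "Bc ** map_matrix complex_of_real C = map_matrix complex_of_real (B_real ** C)"
    by (simp add: Finite_Cartesian_Product.vec_eq_iff Bc_def B_real_def matrix_matrix_mult_def)
  also have "\<dots> = mat 1"
    by (simp add: C_inverse Finite_Cartesian_Product.vec_eq_iff Finite_Cartesian_Product.mat_def)
  finally have "w = Bc *v (map_matrix complex_of_real C *v w)"
    by (simp add: matrix_vector_mul_assoc)
  also have "\<dots> = \<mu> *s (Bc *v w)" by (simp add: w(2) vector_scalar_commute)
  finally have w_eq: "w = \<mu> *s (Bc *v w)" .
  then have "\<mu> \<noteq> 0" using w(1) by auto
  with w_eq have "Bc *v w = (1 / \<mu>) *s w"
    by (metis (no_types, lifting) divide_self_if mult.commute nonzero_divide_eq_eq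
        vector_smult_assoc vector_smult_lid)
  then have "1 < cmod (1 / \<mu>)" using dilation w(1) unfolding int_dilation_def Bc_def by blast
  then show ?thesis using \<open>\<mu> \<noteq> 0\<close> by (simp add: norm_divide divide_less_eq)
qed

lemma zero_digit: "0 \<in> digits"
  unfolding digits_def by (rule CollectI, rule bexI[of _ 0]) (auto simp: half_cube_def)

lemma digit_decomposition_exists: "\<exists>d m. d \<in> digits \<and> k = d + B *v m"
proof -
  obtain m where m: "C *v of_int_vec k - of_int_vec m \<in> half_cube"
    using round_to_half_cube by blast
  have "B_real *v (C *v of_int_vec k - of_int_vec m) = of_int_vec (k - B *v m)"
    by (simp add: matrix_vector_mult_diff_distrib matrix_vector_mul_assoc C_inverse
        of_int_vec_diff B_real_of_int_vec)
  with m have "k - B *v m \<in> digits" unfolding digits_def by blast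
  then show ?thesis by force
qed

lemma digit_decomposition_unique:
  assumes "d1 \<in> digits" "d2 \<in> digits" "d1 + B *v m1 = d2 + B *v m2"
  shows "d1 = d2 \<and> m1 = m2"
proof -
  obtain t1 t2 where t: "t1 \<in> half_cube" "t2 \<in> half_cube"
    and Bt: "B_real *v t1 = of_int_vec d1" "B_real *v t2 = of_int_vec d2"
    using assms(1,2) unfolding digits_def by blast
  have "B_real *v (t1 - t2 - of_int_vec (m2 - m1)) = of_int_vec (d1 - d2 - B *v (m2 - m1))"
    by (simp add: matrix_vector_mult_diff_distrib Bt B_real_of_int_vec of_int_vec_diff)
  also have "d1 - d2 - B *v (m2 - m1) = 0"
    using assms(3) by (simp add: matrix_vector_mult_diff_distrib algebra_simps)
  finally have "B_real *v (t1 - t2 - of_int_vec (m2 - m1)) = 0" by simp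
  then have "t1 - t2 = of_int_vec (m2 - m1)" using B_real_kernel by force
  then have "m2 - m1 = 0" using half_cube_difference_integral t by blast
  then show ?thesis using assms(3) by simp
qed

text \<open>Division with remainder by \<open>B\<close>: \<open>k = digit k + B (quot k)\<close>.\<close>
definition digit :: "int^'n \<Rightarrow> int^'n" where
  "digit k = (SOME d. d \<in> digits \<and> (\<exists>m. k = d + B *v m))"

definition quot :: "int^'n \<Rightarrow> int^'n" where
  "quot k = (SOME m. k = digit k + B *v m)"

lemma digit_quot: "digit k \<in> digits" "k = digit k + B *v quot k"
proof -
  have "\<exists>d. d \<in> digits \<and> (\<exists>m. k = d + B *v m)" using digit_decomposition_exists by blast
  then have "digit k \<in> digits \<and> (\<exists>m. k = digit k + B *v m)"
    unfolding digit_def by (rule someI_ex)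
  then show "digit k \<in> digits" "k = digit k + B *v quot k"
    unfolding quot_def by (auto intro: someI_ex)
qed

lemma digit_quot_unique: "d \<in> digits \<Longrightarrow> k = d + B *v m \<Longrightarrow> digit k = d \<and> quot k = m"
  using digit_decomposition_unique digit_quot by metis

lemma quot_0: "quot 0 = 0"
  using digit_quot_unique[OF zero_digit, of 0 0] by simp

end

context int_dilation_system
begin

text \<open>One radix step is multiplication by \<open>C = B\<^sup>-\<^sup>1\<close> up to an error in the half cube.\<close>
lemma quot_approx: "\<exists>t\<in>half_cube. of_int_vec (quot k) = C *v of_int_vec k - t"
proof -
  obtain t where t: "t \<in> half_cube" "B_real *v t = of_int_vec (digit k)"
    using digit_quot(1) unfolding digits_def by blast
  have "of_int_vec k = B_real *v t + B_real *v of_int_vec (quot k)"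
    using digit_quot(2)[of k] by (metis t(2) of_int_vec_add B_real_of_int_vec)
  then have "C *v of_int_vec k = t + of_int_vec (quot k)"
    by (simp add: matrix_vector_right_distrib matrix_vector_mul_assoc C_inverse)
  with t(1) show ?thesis by (intro bexI[of _ t]) auto
qed

text \<open>Hence \<open>m\<close> radix steps are multiplication by \<open>C\<^sup>m\<close> up to an error controlled by the
  operator norms of the powers of \<open>C\<close>.\<close>
lemma quot_iterate_approx:
  "\<exists>u. of_int_vec ((quot ^^ m) k) = matpow C m *v of_int_vec k - u
     \<and> norm u \<le> real CARD('n) * (\<Sum>j<m. onorm ((*v) (matpow C j)))"
proof (induction m arbitrary: k)
  case 0
  show ?case by (intro exI[of _ 0]) simp
next
  case (Suc m)
  obtain t where t: "t \<in> half_cube" "of_int_vec (quot k) = C *v of_int_vec k - t"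
    using quot_approx by blast
  obtain u where u: "of_int_vec ((quot ^^ m) (quot k)) = matpow C m *v of_int_vec (quot k) - u"
    "norm u \<le> real CARD('n) * (\<Sum>j<m. onorm ((*v) (matpow C j)))"
    using Suc.IH by blast
  have "of_int_vec ((quot ^^ Suc m) k) = matpow C (Suc m) *v of_int_vec k - (matpow C m *v t + u)"
    unfolding funpow_Suc_right o_apply u(1) t(2)
    by (simp add: matrix_vector_mult_diff_distrib matrix_vector_mul_assoc matpow_Suc_right
        del: matpow.simps)
  moreover have "norm (matpow C m *v t + u)
      \<le> real CARD('n) * (\<Sum>j<Suc m. onorm ((*v) (matpow C j)))"
  proof -
    have "norm (matpow C m *v t) \<le> onorm ((*v) (matpow C m)) * norm t"
      by (rule onorm[OF matrix_vector_mul_bounded_linear])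
    also have "\<dots> \<le> onorm ((*v) (matpow C m)) * real CARD('n)"
      using half_cube_norm[OF t(1)] onorm_pos_le[OF matrix_vector_mul_bounded_linear]
      by (rule mult_left_mono)
    finally show ?thesis using u(2) norm_triangle_ineq[of "matpow C m *v t" u]
      by (simp add: algebra_simps)
  qed
  ultimately show ?case by blast
qed

text \<open>All radix orbits eventually stay in one ball.\<close>
lemma quot_orbits_eventually_bounded:
  "\<exists>R. \<forall>k. \<exists>m0. \<forall>m\<ge>m0. norm (of_int_vec ((quot ^^ m) k) :: real^'n) \<le> R"
proof -
  define s where "s j = onorm ((*v) (matpow C j))" for j
  have s_summable: "summable s"
    unfolding s_def using C_eigenvalue_small by (rule matpow_norms_summable)
  have s_nonneg: "0 \<le> s j" for j
    unfolding s_def by (rule onorm_pos_le[OF matrix_vector_mul_bounded_linear])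
  define R where "R = 1 + real CARD('n) * suminf s"
  have "\<exists>m0. \<forall>m\<ge>m0. norm (of_int_vec ((quot ^^ m) k) :: real^'n) \<le> R" for k
  proof -
    let ?x = "of_int_vec k :: real^'n"
    have "(\<lambda>m. s m * norm ?x) \<longlonglongrightarrow> 0"
      using summable_LIMSEQ_zero[OF s_summable] by (rule tendsto_mult_left_zero)
    then have "eventually (\<lambda>m. s m * norm ?x < 1) sequentially"
      by (rule order_tendstoD(2)) simp
    then obtain m0 where m0: "\<And>m. m \<ge> m0 \<Longrightarrow> s m * norm ?x < 1"
      unfolding eventually_sequentially by blast
    have "norm (of_int_vec ((quot ^^ m) k) :: real^'n) \<le> R" if "m \<ge> m0" for m
    proof -
      obtain u where u: "of_int_vec ((quot ^^ m) k) = matpow C m *v ?x - u"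
        "norm u \<le> real CARD('n) * (\<Sum>j<m. s j)"
        using quot_iterate_approx unfolding s_def by blast
      have "(\<Sum>j<m. s j) \<le> suminf s"
        using s_summable s_nonneg by (intro sum_le_suminf) auto
      then have "real CARD('n) * (\<Sum>j<m. s j) \<le> real CARD('n) * suminf s"
        by (rule mult_left_mono) simp
      then have "norm u \<le> real CARD('n) * suminf s" using u(2) by linarith
      moreover have "norm (matpow C m *v ?x) \<le> s m * norm ?x"
        unfolding s_def by (rule onorm[OF matrix_vector_mul_bounded_linear])
      ultimately show ?thesis
        unfolding u(1) R_def using m0[OF that] norm_triangle_ineq4[of "matpow C m *v ?x" u]
        by linarith
    qed
    then show ?thesis by blast
  qed
  then show ?thesis by blast
qed

end

text \<open>A ball contains only finitely many integer vectors.\<close>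
lemma finite_integer_ball: "finite {k::int^'n::finite. norm (of_int_vec k :: real^'n) \<le> R}"
proof -
  let ?c = "\<lceil>R\<rceil>"
  have "{k::int^'n. norm (of_int_vec k :: real^'n) \<le> R} \<subseteq> vec_lambda ` (UNIV \<rightarrow>\<^sub>E {-?c..?c})"
  proof
    fix k :: "int^'n" assume "k \<in> {k. norm (of_int_vec k :: real^'n) \<le> R}"
    then have bound: "\<bar>real_of_int (k $ i)\<bar> \<le> R" for i
      using component_le_norm_cart[of "of_int_vec k :: real^'n" i] by (simp add: of_int_vec_def)
    have "\<bar>real_of_int (k $ i)\<bar> \<le> real_of_int ?c" for i
      using bound[of i] le_of_int_ceiling[of R] by linarith
    then have abs_bound: "\<bar>k $ i\<bar> \<le> ?c" for i by (metis of_int_abs of_int_le_iff)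
    have "k $ i \<in> {-?c..?c}" for i using abs_bound[of i] by (simp add: abs_le_iff)
    then show "k \<in> vec_lambda ` (UNIV \<rightarrow>\<^sub>E {-?c..?c})"
      by (intro image_eqI[of _ _ "vec_nth k"]) auto
  qed
  moreover have "finite (vec_lambda ` (UNIV \<rightarrow>\<^sub>E {-?c..?c}) :: (int^'n) set)"
    by (intro finite_imageI finite_PiE) auto
  ultimately show ?thesis by (rule finite_subset)
qed

text \<open>Splitting off the lowest digit of a radix expansion.\<close>
lemma expansion_shift:
  "matpow X (Suc N) *v s + (\<Sum>j<Suc N. matpow X j *v d j)
     = d 0 + X *v (matpow X N *v s + (\<Sum>j<N. matpow X j *v d (Suc j)))"
  for X :: "'a::comm_ring_1^'n::finite^'n"
  by (simp add: sum.lessThan_Suc_shift matrix_vector_right_distrib matrix_vector_mult_sum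
      matrix_vector_mul_assoc add_ac del: sum.lessThan_Suc)

context int_dilation_system
begin

text \<open>Radix expansions of length \<open>N\<close> are exactly the \<open>N\<close>-step orbits of \<open>quot\<close>: \<open>k\<close> has an
  expansion \<open>B\<^sup>N s + \<Sum>\<^sub>j\<^sub><\<^sub>N B\<^sup>j d\<^sub>j\<close> with digits \<open>d\<^sub>j\<close> iff \<open>quot\<^sup>N k = s\<close>.\<close>
lemma expansion_iff_quot_iterate:
  "(\<exists>d. (\<forall>j<N. d j \<in> digits) \<and> k = matpow B N *v s + (\<Sum>j<N. matpow B j *v d j))
     \<longleftrightarrow> (quot ^^ N) k = s"
proof (induction N arbitrary: k)
  case 0
  show ?case by simp
next
  case (Suc N)
  show ?case
  proof
    assume "\<exists>d. (\<forall>j<Suc N. d j \<in> digits)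
              \<and> k = matpow B (Suc N) *v s + (\<Sum>j<Suc N. matpow B j *v d j)"
    then obtain d where d: "\<forall>j<Suc N. d j \<in> digits"
      and k: "k = d 0 + B *v (matpow B N *v s + (\<Sum>j<N. matpow B j *v d (Suc j)))"
      unfolding expansion_shift by blast
    then have "quot k = matpow B N *v s + (\<Sum>j<N. matpow B j *v d (Suc j))"
      using digit_quot_unique by blast
    moreover have "(quot ^^ N) (matpow B N *v s + (\<Sum>j<N. matpow B j *v d (Suc j))) = s"
      using d by (intro Suc.IH[THEN iffD1] exI[of _ "d \<circ> Suc"]) auto
    ultimately show "(quot ^^ Suc N) k = s" by (simp only: funpow_Suc_right o_apply)
  next
    assume "(quot ^^ Suc N) k = s"
    then have "(quot ^^ N) (quot k) = s" by (simp only: funpow_Suc_right o_apply)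
    then obtain d where d: "\<forall>j<N. d j \<in> digits"
      and quot_k: "quot k = matpow B N *v s + (\<Sum>j<N. matpow B j *v d j)"
      using Suc.IH by blast
    define d' where "d' = case_nat (digit k) d"
    have "k = matpow B (Suc N) *v s + (\<Sum>j<Suc N. matpow B j *v d' j)"
      unfolding expansion_shift by (simp add: d'_def flip: quot_k digit_quot(2))
    moreover have "\<forall>j<Suc N. d' j \<in> digits"
      using d digit_quot(1) by (auto simp: d'_def less_Suc_eq_0_disj)
    ultimately show "\<exists>d. (\<forall>j<Suc N. d j \<in> digits)
              \<and> k = matpow B (Suc N) *v s + (\<Sum>j<Suc N. matpow B j *v d j)" by blast
  qed
qed

text \<open>Finite radix expansions are exactly the orbits of \<open>quot\<close> reaching \<open>0\<close>.\<close>
lemma finite_expansion_iff: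
  "(\<exists>N d. (\<forall>j\<le>N. d j \<in> digits) \<and> k = (\<Sum>j\<le>N. matpow B j *v d j))
     \<longleftrightarrow> (\<exists>a. (quot ^^ a) k = 0)"
proof
  assume "\<exists>N d. (\<forall>j\<le>N. d j \<in> digits) \<and> k = (\<Sum>j\<le>N. matpow B j *v d j)"
  then obtain N d where d: "\<forall>j\<le>N. d j \<in> digits" and k: "k = (\<Sum>j\<le>N. matpow B j *v d j)"
    by blast
  have "\<forall>j<Suc N. d j \<in> digits" using d by (simp add: less_Suc_eq_le)
  moreover have "k = matpow B (Suc N) *v 0 + (\<Sum>j<Suc N. matpow B j *v d j)"
    using k by (simp add: lessThan_Suc_atMost)
  ultimately have "(quot ^^ Suc N) k = 0"
    using expansion_iff_quot_iterate[of "Suc N" k 0] by blast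
  then show "\<exists>a. (quot ^^ a) k = 0" by blast
next
  assume "\<exists>a. (quot ^^ a) k = 0"
  then obtain a where "(quot ^^ a) k = 0" by blast
  then have "(quot ^^ Suc a) k = 0" by (simp add: quot_0)
  then obtain d where "\<forall>j<Suc a. d j \<in> digits"
    "k = matpow B (Suc a) *v 0 + (\<Sum>j<Suc a. matpow B j *v d j)"
    using expansion_iff_quot_iterate[of "Suc a" k 0] by blast
  then show "\<exists>N d. (\<forall>j\<le>N. d j \<in> digits) \<and> k = (\<Sum>j\<le>N. matpow B j *v d j)"
    by (intro exI[of _ a] exI[of _ d]) (simp add: lessThan_Suc_atMost less_Suc_eq_le)
qed

text \<open>Expansions with a tail from a set \<open>P\<close> are exactly the orbits of \<open>quot\<close> reaching \<open>P\<close>.\<close>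
lemma tail_expansion_iff:
  "(\<exists>N s d. s \<in> P \<and> (\<forall>j<N. d j \<in> digits) \<and> k = matpow B N *v s + (\<Sum>j<N. matpow B j *v d j))
     \<longleftrightarrow> (\<exists>N. (quot ^^ N) k \<in> P)"
proof
  assume "\<exists>N s d. s \<in> P \<and> (\<forall>j<N. d j \<in> digits) \<and>
    k = matpow B N *v s + (\<Sum>j<N. matpow B j *v d j)"
  then obtain N s d where s: "s \<in> P" and expansion: "(\<forall>j<N. d j \<in> digits) \<and>
    k = matpow B N *v s + (\<Sum>j<N. matpow B j *v d j)" by blast
  then have "(quot ^^ N) k = s" using expansion_iff_quot_iterate[of N k s] by blast
  with s show "\<exists>N. (quot ^^ N) k \<in> P" by blast
next
  assume "\<exists>N. (quot ^^ N) k \<in> P"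
  then obtain N where "(quot ^^ N) k \<in> P" by blast
  moreover obtain d where "(\<forall>j<N. d j \<in> digits) \<and>
    k = matpow B N *v (quot ^^ N) k + (\<Sum>j<N. matpow B j *v d j)"
    using expansion_iff_quot_iterate[of N k "(quot ^^ N) k"] by blast
  ultimately show "\<exists>N s d. s \<in> P \<and> (\<forall>j<N. d j \<in> digits) \<and>
    k = matpow B N *v s + (\<Sum>j<N. matpow B j *v d j)" by blast
qed

text \<open>The theorem in integer coordinates: the exceptional set consists of the nonzero periodic
  points of \<open>quot\<close>.\<close>
theorem integer_expansion_dichotomy:
  "\<exists>P. finite P \<and> (\<forall>k.
     (\<exists>N d. (\<forall>j\<le>N. d j \<in> digits) \<and> k = (\<Sum>j\<le>N. matpow B j *v d j))
     \<noteq> (\<exists>N s d. s \<in> P \<and> (\<forall>j<N. d j \<in> digits) \<and>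
          k = matpow B N *v s + (\<Sum>j<N. matpow B j *v d j)))"
proof -
  obtain R where "\<forall>k. \<exists>m0. \<forall>m\<ge>m0. norm (of_int_vec ((quot ^^ m) k) :: real^'n) \<le> R"
    using quot_orbits_eventually_bounded by blast
  then have eventually_in_ball:
    "\<exists>m0. \<forall>m\<ge>m0. (quot ^^ m) k \<in> {k. norm (of_int_vec k :: real^'n) \<le> R}" for k
    by simp
  note dichotomy = orbit_dichotomy[OF finite_integer_ball eventually_in_ball quot_0]
  show ?thesis
    unfolding finite_expansion_iff tail_expansion_iff
    by (intro exI[of _ "periodic_points quot - {0}"] conjI allI dichotomy)
qed

end

text \<open>The fundamental domain \<open>F\<^sub>\<Gamma>\<close> is the image of the half cube under \<open>M\<close>.\<close>
lemma fund_dom_eq: "fund_dom M = (\<lambda>t. M *v of_real_vec t) ` half_cube"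
proof (intro Set.set_eqI iffI)
  fix x assume "x \<in> fund_dom M"
  then obtain t where "\<forall>i. -1/2 \<le> t i \<and> t i < 1/2" "x = M *v (\<chi> i. of_real (t i))"
    unfolding fund_dom_def by blast
  then show "x \<in> (\<lambda>t. M *v of_real_vec t) ` half_cube"
    by (intro image_eqI[of _ _ "\<chi> i. t i"]) (simp_all add: of_real_vec_def half_cube_def)
next
  fix x assume "x \<in> (\<lambda>t. M *v of_real_vec t) ` half_cube"
  then obtain t where "t \<in> half_cube" "x = M *v of_real_vec t" by blast
  then show "x \<in> fund_dom M"
    unfolding fund_dom_def half_cube_def of_real_vec_def by (intro CollectI exI[of _ "vec_nth t"]) auto
qed

text \<open>Transfer to the lattice \<open>\<Gamma> = M \<int>\<^sup>n\<close>: the map \<open>k \<mapsto> M k\<close> identifies \<open>\<int>\<^sup>n\<close> with \<open>\<Gamma>\<close>,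
  intertwines \<open>B\<close> with \<open>A = M B M\<^sup>-\<^sup>1\<close>, and maps the digits onto \<open>D = A(F\<^sub>\<Gamma>) \<inter> \<Gamma>\<close>.\<close>

locale lattice_dilation = int_dilation_system B
  for B :: "int^'n::finite^'n" +
  fixes M A :: "'a::real_normed_field^'n^'n"
  assumes M_invertible: "invertible M"
    and conjugate: "matrix_inv M ** A ** M = map_matrix of_int B"
begin

definition lattice_point :: "int^'n \<Rightarrow> 'a^'n" where
  "lattice_point k = M *v of_int_vec k"

lemma M_cancel: "M *v (matrix_inv M *v y) = y" "matrix_inv M *v (M *v y) = y"
  using matrix_inv_both_sides[OF M_invertible] by (simp_all add: matrix_vector_mul_assoc)

text \<open>\<open>A\<close> acts on \<open>M\<close>-coordinates as \<open>B\<close> does.\<close>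
lemma A_conjugate_action: "A *v (M *v v) = M *v (map_matrix of_int B *v v)"
proof -
  have "A *v (M *v v) = M *v (matrix_inv M *v (A *v (M *v v)))" by (simp only: M_cancel)
  also have "\<dots> = M *v ((matrix_inv M ** A ** M) *v v)"
    by (simp add: matrix_vector_mul_assoc matrix_mul_assoc)
  finally show ?thesis by (simp only: conjugate)
qed

lemma A_lattice_point: "A *v lattice_point k = lattice_point (B *v k)"
  by (simp add: lattice_point_def A_conjugate_action of_int_matrix_mult_vec)

lemma matpow_A_lattice_point: "matpow A j *v lattice_point k = lattice_point (matpow B j *v k)"
proof (induction j)
  case 0
  show ?case by simp
next
  case (Suc j)
  have "matpow A (Suc j) *v lattice_point k = A *v (matpow A j *v lattice_point k)"
    by (simp add: matrix_vector_mul_assoc)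
  also have "\<dots> = lattice_point (B *v (matpow B j *v k))"
    by (simp only: Suc.IH A_lattice_point)
  finally show ?case by (simp add: matrix_vector_mul_assoc)
qed

lemma lattice_point_0 [simp]: "lattice_point 0 = 0"
  by (simp add: lattice_point_def)

lemma lattice_point_add: "lattice_point (a + b) = lattice_point a + lattice_point b"
  by (simp add: lattice_point_def of_int_vec_add matrix_vector_right_distrib)

lemma lattice_point_inj: "lattice_point a = lattice_point b \<Longrightarrow> a = b"
  unfolding lattice_point_def by (metis M_cancel(2) of_int_vec_inj)

lemma lattice_point_sum: "lattice_point (\<Sum>j\<in>J. f j) = (\<Sum>j\<in>J. lattice_point (f j))"
  by (induction J rule: infinite_finite_induct)
     (simp_all add: lattice_point_add)

lemma lattice_point_expansion:
  "lattice_point (matpow B N *v s + (\<Sum>j\<in>J. matpow B j *v d j))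
     = matpow A N *v lattice_point s + (\<Sum>j\<in>J. matpow A j *v lattice_point (d j))"
  by (simp add: lattice_point_add lattice_point_sum matpow_A_lattice_point)

lemma lattice_eq_range: "lattice M = range lattice_point"
proof (intro Set.set_eqI iffI)
  fix x assume "x \<in> lattice M"
  then obtain k where "x = M *v (\<chi> i. of_int (k i))" unfolding Defs.lattice_def by blast
  then show "x \<in> range lattice_point"
    by (intro range_eqI[of _ _ "\<chi> i. k i"]) (simp add: lattice_point_def of_int_vec_def)
next
  fix x assume "x \<in> range lattice_point"
  then show "x \<in> lattice M" unfolding Defs.lattice_def lattice_point_def of_int_vec_def by blast
qed

lemma digit_image: "{A *v y | y. y \<in> fund_dom M} \<inter> lattice M = lattice_point ` digits"
proof -
  have M_of_real_inj: "M *v of_real_vec u = M *v of_real_vec v \<Longrightarrow> u = v" for u v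
    by (metis M_cancel(2) of_real_vec_inj)
  have A_image: "A *v (M *v of_real_vec t) = M *v of_real_vec (B_real *v t)" for t
    by (simp add: A_conjugate_action of_int_matrix_mult_of_real_vec B_real_def)
  have lattice_point_real: "lattice_point k = M *v of_real_vec (of_int_vec k)" for k
    by (simp add: lattice_point_def of_real_of_int_vec)
  show ?thesis
  proof (intro Set.set_eqI iffI)
    fix x assume "x \<in> {A *v y | y. y \<in> fund_dom M} \<inter> lattice M"
    then obtain t k where "t \<in> half_cube" "x = A *v (M *v of_real_vec t)" "x = lattice_point k"
      unfolding fund_dom_eq lattice_eq_range by blast
    then have "t \<in> half_cube" "x = M *v of_real_vec (B_real *v t)" "x = lattice_point k"
      unfolding A_image by simp_all
    then show "x \<in> lattice_point ` digits"
      unfolding digits_def lattice_point_real by (blast dest: M_of_real_inj)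
  next
    fix x assume "x \<in> lattice_point ` digits"
    then obtain k t where t: "t \<in> half_cube" "B_real *v t = of_int_vec k" and x: "x = lattice_point k"
      unfolding digits_def by blast
    then have "x = A *v (M *v of_real_vec t)" unfolding A_image lattice_point_real by simp
    with t(1) x show "x \<in> {A *v y | y. y \<in> fund_dom M} \<inter> lattice M"
      unfolding fund_dom_eq lattice_eq_range by blast
  qed
qed

text \<open>Radix expansions in \<open>\<Gamma>\<close> with digits in \<open>D\<close> correspond to radix expansions in \<open>\<int>\<^sup>n\<close>.\<close>
lemma expansion_transfer:
  "(\<exists>d. (\<forall>j\<in>J. d j \<in> lattice_point ` digits) \<and>
      lattice_point k = matpow A N *v lattice_point s + (\<Sum>j\<in>J. matpow A j *v d j))
   \<longleftrightarrow> (\<exists>d. (\<forall>j\<in>J. d j \<in> digits) \<and> k = matpow B N *v s + (\<Sum>j\<in>J. matpow B j *v d j))"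
proof
  assume "\<exists>d. (\<forall>j\<in>J. d j \<in> lattice_point ` digits) \<and>
      lattice_point k = matpow A N *v lattice_point s + (\<Sum>j\<in>J. matpow A j *v d j)"
  then obtain d where d: "\<forall>j\<in>J. \<exists>e. e \<in> digits \<and> d j = lattice_point e"
    and k: "lattice_point k = matpow A N *v lattice_point s + (\<Sum>j\<in>J. matpow A j *v d j)"
    by blast
  from bchoice[OF d] obtain e where e: "\<forall>j\<in>J. e j \<in> digits \<and> d j = lattice_point (e j)"
    by blast
  have "lattice_point k = lattice_point (matpow B N *v s + (\<Sum>j\<in>J. matpow B j *v e j))"
    unfolding k lattice_point_expansion using e by simp
  then show "\<exists>d. (\<forall>j\<in>J. d j \<in> digits) \<and> k = matpow B N *v s + (\<Sum>j\<in>J. matpow B j *v d j)"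
    using e lattice_point_inj by blast
next
  assume "\<exists>d. (\<forall>j\<in>J. d j \<in> digits) \<and> k = matpow B N *v s + (\<Sum>j\<in>J. matpow B j *v d j)"
  then obtain d where "\<forall>j\<in>J. d j \<in> digits" "k = matpow B N *v s + (\<Sum>j\<in>J. matpow B j *v d j)"
    by blast
  then show "\<exists>d. (\<forall>j\<in>J. d j \<in> lattice_point ` digits) \<and>
      lattice_point k = matpow A N *v lattice_point s + (\<Sum>j\<in>J. matpow A j *v d j)"
    by (intro exI[of _ "lattice_point \<circ> d"]) (simp add: lattice_point_expansion)
qed

end

context lattice_dilation
begin

text \<open>The theorem for the lattice, with \<open>D\<close> given as the image of the integer digits.\<close>
theorem lattice_expansion_dichotomy:
  "\<exists>S. finite S \<and> S \<subseteq> lattice M \<and>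
    (\<forall>x\<in>lattice M.
       (\<exists>N d. (\<forall>j\<le>N. d j \<in> lattice_point ` digits) \<and> x = (\<Sum>j\<le>N. matpow A j *v d j))
       \<noteq>
       (\<exists>N s d. s \<in> S \<and> (\<forall>j<N. d j \<in> lattice_point ` digits) \<and>
          x = matpow A N *v s + (\<Sum>j<N. matpow A j *v d j)))"
proof -
  obtain P where P: "finite P" and dichotomy: "\<And>k.
     (\<exists>N d. (\<forall>j\<le>N. d j \<in> digits) \<and> k = (\<Sum>j\<le>N. matpow B j *v d j))
     \<noteq> (\<exists>N s d. s \<in> P \<and> (\<forall>j<N. d j \<in> digits) \<and>
          k = matpow B N *v s + (\<Sum>j<N. matpow B j *v d j))"
    using integer_expansion_dichotomy by blast
  have finite_iff: "(\<exists>d. (\<forall>j\<le>N. d j \<in> lattice_point ` digits) \<and>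
        lattice_point k = (\<Sum>j\<le>N. matpow A j *v d j))
      \<longleftrightarrow> (\<exists>d. (\<forall>j\<le>N. d j \<in> digits) \<and> k = (\<Sum>j\<le>N. matpow B j *v d j))" for N k
    using expansion_transfer[of "{..N}" k 0 0] by (simp add: Ball_def)
  have tail_iff: "(\<exists>s d. s \<in> lattice_point ` P \<and> (\<forall>j<N. d j \<in> lattice_point ` digits) \<and>
        lattice_point k = matpow A N *v s + (\<Sum>j<N. matpow A j *v d j))
      \<longleftrightarrow> (\<exists>s d. s \<in> P \<and> (\<forall>j<N. d j \<in> digits) \<and>
        k = matpow B N *v s + (\<Sum>j<N. matpow B j *v d j))" for N k
  proof -
    have "(\<exists>s d. s \<in> lattice_point ` P \<and> (\<forall>j<N. d j \<in> lattice_point ` digits) \<and>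
          lattice_point k = matpow A N *v s + (\<Sum>j<N. matpow A j *v d j))
        \<longleftrightarrow> (\<exists>s\<in>P. \<exists>d. (\<forall>j<N. d j \<in> lattice_point ` digits) \<and>
          lattice_point k = matpow A N *v lattice_point s + (\<Sum>j<N. matpow A j *v d j))"
      by blast
    also have "\<dots> \<longleftrightarrow> (\<exists>s\<in>P. \<exists>d. (\<forall>j<N. d j \<in> digits) \<and>
          k = matpow B N *v s + (\<Sum>j<N. matpow B j *v d j))"
      using expansion_transfer[of "{..<N}" k N] by (simp add: Ball_def)
    finally show ?thesis by blast
  qed
  show ?thesis
  proof (intro exI[of _ "lattice_point ` P"] conjI ballI)
    show "finite (lattice_point ` P)" using P by simp
    show "lattice_point ` P \<subseteq> lattice M" unfolding lattice_eq_range by blast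
    fix x assume "x \<in> lattice M"
    then obtain k where "x = lattice_point k" unfolding lattice_eq_range by blast
    then show "(\<exists>N d. (\<forall>j\<le>N. d j \<in> lattice_point ` digits) \<and> x = (\<Sum>j\<le>N. matpow A j *v d j))
      \<noteq> (\<exists>N s d. s \<in> lattice_point ` P \<and> (\<forall>j<N. d j \<in> lattice_point ` digits) \<and>
          x = matpow A N *v s + (\<Sum>j<N. matpow A j *v d j))"
      using dichotomy[of k] finite_iff[of _ k] tail_iff[of _ k] by simp
  qed
qed

end

theorem mainTheorem9:
  fixes M A :: "'a::real_normed_field^'n^'n"
  assumes "invertible M"
    and "dilation_for M A"
  defines "D \<equiv> {A *v y | y. y \<in> fund_dom M} \<inter> lattice M"
  shows "\<exists>S. finite S \<and> S \<subseteq> lattice M \<and>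
    (\<forall>x\<in>lattice M.
       (\<exists>N d. (\<forall>j\<le>N. d j \<in> D) \<and> x = (\<Sum>j\<le>N. matpow A j *v d j))
       \<noteq>
       (\<exists>N s d. s \<in> S \<and> (\<forall>j<N. d j \<in> D) \<and>
          x = matpow A N *v s + (\<Sum>j<N. matpow A j *v d j)))"
proof -
  obtain B where "int_dilation B" and "matrix_inv M ** A ** M = map_matrix of_int B"
    using assms(2) unfolding dilation_for_def by blast
  then interpret lattice_dilation B M A
    using assms(1) by unfold_locales
  show ?thesis
    unfolding D_def digit_image by (rule lattice_expansion_dichotomy)
qed

end
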